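(* Let $N$ denote the number of co-even induced subgraphs of $P_{q}$. Then \begin{equation*} N=\begin{cases} 2^{\frac{q+1}{2}} & \text{if $q\equiv 1\pmod{8}$},\\ 2 & \text{if $q\equiv 5\pmod{8}$}.\end{cases} \end{equation*} In particular, if $q\equiv 5\pmod{8}$, then there exist only trivial co-even induced subgraphs of $P_{q}$, namely the empty graph and $P_{q}$ itself.
   Context: Let $q$ be a prime power with $q\equiv 1\pmod{4}$ and let $\mathbb{F}_{q}$ be the finite field with $q$ elements. The Paley graph $P_{q}$ is the graph on vertex set $\mathbb{F}_{q}$ in which two vertices $x,y$ are adjacent if and only if $x-y$ is a nonzero square in $\mathbb{F}_{q}$. An induced subgraph $H$ of a graph $G$ is called even if every vertex of $H$ has even degree in $H$. A partition $V(G)=V_{1}\sqcup V_{2}$ is an even-even partition if both induced subgraphs $G[V_{1}]$ and $G[V_{2}]$ are even; in that case $G[V_{1}]$ and $G[V_{2}]$ are called a pair of co-even induced subgraphs of $G$. Thus $N$ counts the subsets $V_{1}\subseteq\mathbb{F}_{q}$ (including the empty set and $\mathbb{F}_{q}$ itself) such that both $P_{q}[V_{1}]$ and $P_{q}[\mathbb{F}_{q}\setminus V_{1}]$ are even induced subgraphs. *)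

theory Defs
  imports
    "Graph_Theory.Graph_Theory"
    "HOL-Library.Cardinality"
    "HOL-Computational_Algebra.Nth_Powers"
    "HOL-Computational_Algebra.Polynomial"
    "HOL-Number_Theory.Cong"
    "HOL-Number_Theory.Prime_Powers"
begin

text \<open>
  An undirected graph is represented, as usual for this graph library, by a digraph with a
  symmetric arc relation; the degree of a vertex is then its out-degree.
\<close>

definition paley_graph :: "'a :: {field, finite} pair_pre_digraph" where
  "paley_graph = \<lparr> pverts = UNIV, parcs = {(x, y). x - y \<noteq> 0 \<and> is_square (x - y)} \<rparr>"

definition even_graph :: "('a, 'b) pre_digraph \<Rightarrow> bool" where
  "even_graph H \<longleftrightarrow> (\<forall>v \<in> verts H. even (out_degree H v))"

definition even_even_partition :: "('a, 'b) pre_digraph \<Rightarrow> 'a set \<Rightarrow> 'a set \<Rightarrow> bool" where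
  "even_even_partition G V\<^sub>1 V\<^sub>2 \<longleftrightarrow>
     V\<^sub>1 \<union> V\<^sub>2 = verts G \<and> V\<^sub>1 \<inter> V\<^sub>2 = {} \<and> even_graph (G \<restriction> V\<^sub>1) \<and> even_graph (G \<restriction> V\<^sub>2)"

definition coeven_induced_subgraphs :: "('a, 'b) pre_digraph \<Rightarrow> ('a, 'b) pre_digraph set" where
  "coeven_induced_subgraphs G = {G \<restriction> V\<^sub>1 | V\<^sub>1 V\<^sub>2. even_even_partition G V\<^sub>1 V\<^sub>2}"

text \<open>
  Counting co-even induced subgraphs is the same as counting the possible first parts of an
  even-even partition.
\<close>

lemma card_coeven_induced_subgraphs:
  "card (coeven_induced_subgraphs G) =
     card {V\<^sub>1. V\<^sub>1 \<subseteq> verts G \<and> even_graph (G \<restriction> V\<^sub>1) \<and> even_graph (G \<restriction> (verts G - V\<^sub>1))}"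
    (is "_ = card ?S")
proof -
  have "V\<^sub>2 = verts G - V\<^sub>1" if "even_even_partition G V\<^sub>1 V\<^sub>2" for V\<^sub>1 V\<^sub>2
    using that unfolding even_even_partition_def by blast
  moreover have "even_even_partition G V\<^sub>1 (verts G - V\<^sub>1) \<longleftrightarrow> V\<^sub>1 \<in> ?S" for V\<^sub>1
    unfolding even_even_partition_def by blast
  ultimately have "coeven_induced_subgraphs G = (\<lambda>V. G \<restriction> V) ` ?S"
    unfolding coeven_induced_subgraphs_def image_def by blast
  moreover have "inj_on (\<lambda>V. G \<restriction> V) ?S"
    by (rule inj_onI) (metis induce_subgraph_verts)
  ultimately show ?thesis
    by (simp add: card_image)
qed

text \<open>
  The arc relation of the Paley graph is indeed symmetric, because \<open>-1\<close> is a square.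
\<close>

lemma finite_field_power_card_minus_1:
  fixes x :: "'a :: {field, finite}"
  assumes "x \<noteq> 0"
  shows "x ^ (CARD('a) - 1) = 1"
proof -
  let ?U = "UNIV - {0 :: 'a}"
  have "bij_betw ((*) x) ?U ?U"
    by (rule bij_betwI[where g = "\<lambda>y. y / x"]) (use assms in auto)
  then have "(\<Prod>y\<in>?U. x * y) = (\<Prod>y\<in>?U. y)"
    by (rule prod.reindex_bij_betw)
  moreover have "(\<Prod>y\<in>?U. x * y) = x ^ (CARD('a) - 1) * (\<Prod>y\<in>?U. y)"
    by (simp add: prod.distrib card_Diff_subset)
  moreover have "(\<Prod>y\<in>?U. y) \<noteq> 0"
    by simp
  ultimately show ?thesis
    by simp
qed

lemma is_square_minus_1:
  assumes "[CARD('a :: {field, finite}) = 1] (mod 4)"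
  shows "is_square (-1 :: 'a)"
proof -
  have gt1: "CARD('a) > 1"
    using card_mono[of "UNIV :: 'a set" "{0, 1}"] by simp
  define k where "k = CARD('a) div 4"
  have q: "CARD('a) = 4 * k + 1"
    using assms unfolding cong_def k_def by (metis mod_mult_div_eq mod_less one_less_numeral_iff semiring_norm(76) add.commute)
  have k: "k > 0" using q gt1 by simp
  let ?p = "monom 1 (2 * k) - 1 :: 'a poly"
  have "coeff ?p 0 \<noteq> 0" using k by simp
  then have p: "?p \<noteq> 0" by fastforce
  have "degree ?p \<le> 2 * k"
    by (intro degree_diff_le) (auto simp: degree_monom_le)
  then have "card {x. poly ?p x = 0} \<le> 2 * k"
    using card_poly_roots_bound[OF p] by linarith
  moreover have "card (UNIV - {0 :: 'a}) = 4 * k"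
    using q by (simp add: card_Diff_subset)
  ultimately have "\<not> UNIV - {0} \<subseteq> {x. poly ?p x = 0}"
    using k card_mono[of "{x. poly ?p x = 0}" "UNIV - {0}"] by fastforce
  then obtain x :: 'a where x: "x \<noteq> 0" "x ^ (2 * k) \<noteq> 1"
    by (auto simp: poly_monom)
  have "(x ^ (2 * k))\<^sup>2 = 1"
    using finite_field_power_card_minus_1[OF x(1)] q by (simp add: power_mult [symmetric] mult.commute)
  then have "x ^ (2 * k) = -1"
    using x(2) power2_eq_1_iff by blast
  then have "-1 = (x ^ k)\<^sup>2"
    by (simp add: power_mult [symmetric] mult.commute)
  then show ?thesis
    by (metis is_nth_power_def)
qed

lemma pair_graph_paley_graph:
  assumes "[CARD('a :: {field, finite}) = 1] (mod 4)"
  shows "pair_graph (paley_graph :: 'a pair_pre_digraph)"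
proof -
  have "is_square (y - x)" if "is_square (x - y)" for x y :: 'a
    using is_nth_power_mult[OF is_square_minus_1[OF assms] that] by simp
  then show ?thesis
    by unfold_locales (auto simp: paley_graph_def symmetric_def intro!: symI)
qed

end

theory Submission
  imports Defs "HOL-Library.Z2"
begin

text \<open>
  Let \<open>A\<close> be the adjacency matrix of the Paley graph over the field with two elements. All degrees
  \<open>(q - 1) / 2\<close> are even, so \<open>V\<^sub>1\<close> is a part of an even-even partition iff its indicator vector lies
  in \<open>ker A\<close>. Factoring \<open>a\<^sup>2 + b\<^sup>2 = (a + i b) (a - i b)\<close> with \<open>i\<^sup>2 = - 1\<close>, the equation \<open>a\<^sup>2 + b\<^sup>2 = d\<close>
  has \<open>q - 1\<close> solutions for \<open>d \<noteq> 0\<close>; this gives the numbers of common neighbours and hence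
  \<open>A\<^sup>2 = A + \<mu> (I + J)\<close> with \<open>\<mu> = (q - 1) / 4\<close> and \<open>J\<close> the all-ones matrix.

  If \<open>\<mu>\<close> is odd, \<open>A u = 0\<close> forces \<open>u = J u\<close>, so \<open>u\<close> is constant. If \<open>\<mu>\<close> is even, \<open>A\<close> is idempotent, so
  \<open>2 ^ q = |ker A| |ker (I + A)|\<close>. Multiplication by a nonsquare maps the graph onto its complement,
  whose matrix is \<open>I + J + A\<close>. The kernel of the latter consists of \<open>ker (I + A)\<close>, its
  vectors of even weight, and the translate of \<open>ker (I + A)\<close> by the all-ones vector. Hence
  \<open>|ker A| = 2 |ker (I + A)|\<close> and \<open>|ker A|\<^sup>2 = 2 ^ (q + 1)\<close>.
\<close>

section \<open>Counting by fibres and arithmetic in the two-element field\<close>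

lemma card_eq_mult_card_fibres:
  assumes "finite A" "finite B" "f ` A \<subseteq> B" "\<And>y. y \<in> B \<Longrightarrow> card {x \<in> A. f x = y} = n"
  shows "card A = n * card B"
proof -
  have "card A = (\<Sum>y\<in>B. \<Sum>x\<in>{x \<in> A. f x = y}. 1)"
    using sum.group[OF assms(1-3), of "\<lambda>_. 1 :: nat"] by simp
  also have "\<dots> = n * card B"
    using assms(4) by simp
  finally show ?thesis .
qed

text \<open>These rules turn ring expressions into bit operations, which defeats ring normalisation.\<close>

declare add_bit_eq_xor [simp del] mult_bit_eq_and [simp del]

lemma bit_add_self [simp]: "b + b = 0" "b + (b + c) = c" for b c :: bit
  by (cases b; cases c; simp)+

lemma bit_add_eq_0_iff: "b + c = 0 \<longleftrightarrow> b = c" for b c :: bit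
  by (cases b; cases c; simp)

lemma of_nat_bit: "of_nat n = (of_bool (odd n) :: bit)"
  by (induction n) auto

lemma UNIV_bit: "(UNIV :: bit set) = {0, 1}"
  by auto

instance bit :: finite
  by standard (simp add: UNIV_bit)

lemma card_bit: "CARD(bit) = 2"
  unfolding UNIV_bit by simp

section \<open>Squares in a finite field of order 1 modulo 4\<close>

definition nonzero_squares :: "'a :: field set" where
  "nonzero_squares = {x. x \<noteq> 0 \<and> is_square x}"

lemma nonzero_squares_altdef: "nonzero_squares = {x ^ 2 | x :: 'a :: field. x \<noteq> 0}"
  by (auto simp: nonzero_squares_def is_nth_power_def)

lemma mult_in_nonzero_squares:
  "x \<in> nonzero_squares \<Longrightarrow> y \<in> nonzero_squares \<Longrightarrow> x * y \<in> nonzero_squares"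
  unfolding nonzero_squares_def by (auto intro: is_nth_power_mult)

lemma inverse_in_nonzero_squares:
  "x \<in> nonzero_squares \<Longrightarrow> inverse x \<in> nonzero_squares"
  unfolding nonzero_squares_altdef by (force simp flip: power_inverse)

locale field_card_1_mod_4 =
  fixes field_type :: "'a :: {field, finite} itself"
  assumes card_cong: "[CARD('a) = 1] (mod 4)"
begin

lemma card_field: "CARD('a) = 4 * (CARD('a) div 4) + 1"
  using card_cong unfolding cong_def by presburger

text \<open>Translation by 1 permutes the field, so summing all elements gives
  \<open>CARD('a) = 0\<close> in the field. Since \<open>CARD('a)\<close> has the form
  \<open>4 * k + 1\<close>, \<open>2 = 0\<close> would yield \<open>1 = 0\<close>.\<close>

lemma two_neq_zero: "(2 :: 'a) \<noteq> 0"
proof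
  assume two: "(2 :: 'a) = 0"
  have "bij_betw (\<lambda>x :: 'a. x + 1) UNIV UNIV"
    by (rule bij_betwI[where g = "\<lambda>x. x - 1"]) auto
  then have "(\<Sum>x\<in>UNIV. x + 1) = (\<Sum>x\<in>UNIV. x :: 'a)"
    by (rule sum.reindex_bij_betw)
  then have "of_nat (CARD('a)) = (0 :: 'a)"
    by (simp add: sum.distrib)
  moreover have "of_nat (CARD('a)) = (2 * 2 * of_nat (CARD('a) div 4) + 1 :: 'a)"
    by (subst card_field) simp
  ultimately show False
    using two by simp
qed

text \<open>The roots are \<open>r\<close> and \<open>- r\<close>, distinct because the
  characteristic is not 2. The second claim lets fibre counts carry the side condition
  \<open>x \<noteq> 0\<close> for free.\<close>

lemma card_square_roots:
  assumes "y \<in> (nonzero_squares :: 'a set)"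
  shows "card {x. x ^ 2 = y} = 2" "{x. x ^ 2 = y \<and> x \<noteq> 0} = {x. x ^ 2 = y}"
proof -
  obtain r where r: "y = r ^ 2" "r \<noteq> 0"
    using assms unfolding nonzero_squares_altdef by blast
  have "r \<noteq> - r"
    using r two_neq_zero by (metis add_eq_0_iff mult_2 mult_eq_0_iff)
  moreover have "{x. x ^ 2 = y} = {r, - r}"
    using r by (auto simp: power2_eq_iff)
  ultimately show "card {x. x ^ 2 = y} = 2"
    by simp
  show "{x. x ^ 2 = y \<and> x \<noteq> 0} = {x. x ^ 2 = y}"
    using r by auto
qed

lemma card_nonzero_squares: "card (nonzero_squares :: 'a set) = 2 * (CARD('a) div 4)"
proof -
  have "card (UNIV - {0 :: 'a}) = 2 * card (nonzero_squares :: 'a set)"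
  proof (rule card_eq_mult_card_fibres[where f = "\<lambda>x. x ^ 2"])
    fix y :: 'a assume "y \<in> nonzero_squares"
    then show "card {x \<in> UNIV - {0}. x ^ 2 = y} = 2"
      using card_square_roots[of y] by (simp add: conj_commute)
  qed (auto simp: nonzero_squares_altdef)
  then show ?thesis
    using card_field by (simp add: card_Diff_subset)
qed

lemma uminus_in_nonzero_squares: "- x \<in> nonzero_squares \<longleftrightarrow> x \<in> (nonzero_squares :: 'a set)"
proof -
  have "- 1 \<in> (nonzero_squares :: 'a set)"
    using is_square_minus_1[OF card_cong] by (simp add: nonzero_squares_def)
  then show ?thesis
    using mult_in_nonzero_squares[of "- 1" x] mult_in_nonzero_squares[of "- 1" "- x"] by auto
qed

text \<open>A nonsquare \<open>g\<close> maps the nonzero squares injectively into the nonsquares.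
  Both sets have half of the nonzero elements, so the map is onto, and \<open>g\<close> swaps the
  two classes.\<close>

lemma obtain_nonsquare:
  obtains g :: 'a where "g \<noteq> 0"
    "\<And>x. g * x \<in> nonzero_squares \<longleftrightarrow> x \<noteq> 0 \<and> x \<notin> nonzero_squares"
proof -
  let ?Q = "nonzero_squares :: 'a set"
  have zero: "0 \<notin> ?Q"
    by (simp add: nonzero_squares_def)
  have "CARD('a) > 1"
    using card_mono[of "UNIV :: 'a set" "{0, 1}"] by simp
  then have "CARD('a) div 4 > 0"
    using card_field by linarith
  then have "card ?Q < card (UNIV - {0 :: 'a})"
    using card_nonzero_squares card_field by (simp add: card_Diff_subset)
  then obtain g :: 'a where g: "g \<noteq> 0" "g \<notin> ?Q"
    by (metis DiffE UNIV_I card_mono finite insertI1 linorder_not_less subsetI)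
  have gQ: "g * x \<notin> ?Q" if "x \<in> ?Q" for x
    using mult_in_nonzero_squares[of "g * x" "inverse x"] inverse_in_nonzero_squares[OF that] g that zero
    by (metis mult.assoc mult.right_neutral right_inverse)
  have "(*) g ` ?Q = UNIV - {0} - ?Q"
  proof (rule card_subset_eq)
    show "(*) g ` ?Q \<subseteq> UNIV - {0} - ?Q"
      using g gQ zero by auto
    have "card (UNIV - {0} - ?Q) = CARD('a) - 1 - card ?Q"
      using zero by (subst card_Diff_subset) (auto simp: card_Diff_subset)
    also have "\<dots> = card ?Q"
      using card_nonzero_squares card_field by simp
    finally show "card ((*) g ` ?Q) = card (UNIV - {0} - ?Q)"
      using g by (simp add: card_image inj_on_def)
  qed simp
  then have img: "x \<in> (*) g ` ?Q \<longleftrightarrow> x \<noteq> 0 \<and> x \<notin> ?Q" for x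
    by simp
  have "g * x \<in> ?Q \<longleftrightarrow> x \<noteq> 0 \<and> x \<notin> ?Q" for x
    using img[of "g * x"] g gQ zero by (auto simp: image_iff)
  with g show ?thesis
    using that by blast
qed

section \<open>Sums of two squares and common neighbours\<close>

lemma card_sum_two_squares:
  assumes "d \<noteq> (0 :: 'a)"
  shows "card {(a, b). a ^ 2 + b ^ 2 = d} = 4 * (CARD('a) div 4)"
proof -
  obtain i :: 'a where i: "i ^ 2 = - 1"
    using is_square_minus_1[OF card_cong] by (metis is_nth_power_def)
  have i0: "i \<noteq> 0" and ii: "i * i = - 1"
    using i by (auto simp: power2_eq_square)
  have four: "(4 :: 'a) \<noteq> 0"
    using two_neq_zero by (metis mult_2 mult_eq_0_iff numeral_Bit0)
  have fact: "a ^ 2 + b ^ 2 = (a + i * b) * (a - i * b)" for a b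
  proof -
    have "(a + i * b) * (a - i * b) = a ^ 2 - (i * i) * b ^ 2"
      by (simp add: algebra_simps power2_eq_square)
    then show ?thesis
      by (simp add: ii)
  qed
  have "bij_betw (\<lambda>(a, b). a + i * b) {(a, b). a ^ 2 + b ^ 2 = d} (UNIV - {0})"
  \<comment> \<open>The inverse solves the linear system \<open>a + i * b = u\<close>,
    \<open>a - i * b = d / u\<close>.\<close>
  proof (rule bij_betwI[where g = "\<lambda>u. ((u + d / u) / 2, (u - d / u) / (2 * i))"])
    show "(\<lambda>(a, b). a + i * b) \<in> {(a, b). a ^ 2 + b ^ 2 = d} \<rightarrow> UNIV - {0}"
      using assms fact by auto
    show "(\<lambda>u. ((u + d / u) / 2, (u - d / u) / (2 * i))) \<in> UNIV - {0} \<rightarrow> {(a, b). a ^ 2 + b ^ 2 = d}"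
    proof (rule funcsetI)
      fix u :: 'a assume "u \<in> UNIV - {0}"
      then have "u \<noteq> 0"
        by simp
      then have "(u + d / u) / 2 + (u - d / u) / 2 = u" "(u + d / u) / 2 - (u - d / u) / 2 = d / u"
        using two_neq_zero four by (simp_all add: field_simps)
      moreover have "i * ((u - d / u) / (2 * i)) = (u - d / u) / 2"
        using i0 by simp
      ultimately have "((u + d / u) / 2) ^ 2 + ((u - d / u) / (2 * i)) ^ 2 = d"
        unfolding fact using \<open>u \<noteq> 0\<close> by (simp only:) simp
      then show "((u + d / u) / 2, (u - d / u) / (2 * i)) \<in> {(a, b). a ^ 2 + b ^ 2 = d}"
        by simp
    qed
  next
    fix p :: "'a \<times> 'a" assume "p \<in> {(a, b). a ^ 2 + b ^ 2 = d}"
    then obtain a b where p: "p = (a, b)" "(a + i * b) * (a - i * b) = d"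
      using fact by auto
    then have "d / (a + i * b) = a - i * b"
      using assms by auto
    then show "(\<lambda>u. ((u + d / u) / 2, (u - d / u) / (2 * i))) (case p of (a, b) \<Rightarrow> a + i * b) = p"
      using p i0 two_neq_zero by (simp add: field_simps)
  next
    fix u :: 'a assume "u \<in> UNIV - {0}"
    then show "(case ((u + d / u) / 2, (u - d / u) / (2 * i)) of (a, b) \<Rightarrow> a + i * b) = u"
      using i0 two_neq_zero four by (simp add: field_simps)
  qed
  then have "card {(a, b). a ^ 2 + b ^ 2 = d} = card (UNIV - {0 :: 'a})"
    by (rule bij_betw_same_card)
  then show ?thesis
    using card_field by (simp add: card_Diff_subset)
qed

text \<open>Solutions of \<open>a ^ 2 + b ^ 2 = d\<close> with both coordinates nonzero come in
  fours over \<open>y = a ^ 2\<close>. The remaining ones lie on the axes, and there are four of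
  them exactly when \<open>d\<close> is a square. Dividing the total by 4 gives the claim. For
  \<open>d = x - z\<close> the set corresponds to the common neighbours of \<open>x\<close> and
  \<open>z\<close>.\<close>

lemma card_common_neighbours:
  assumes "d \<noteq> (0 :: 'a)"
  shows "card {y. y \<in> nonzero_squares \<and> d - y \<in> nonzero_squares} + of_bool (d \<in> nonzero_squares) =
    CARD('a) div 4"
proof -
  let ?Q = "nonzero_squares :: 'a set"
  let ?R = "{x. x ^ 2 = d}"
  let ?S = "{(a, b). a ^ 2 + b ^ 2 = d}"
  let ?T = "{(a, b). a ^ 2 + b ^ 2 = d \<and> a \<noteq> 0 \<and> b \<noteq> 0}"
  have T: "card ?T = 4 * card {y. y \<in> ?Q \<and> d - y \<in> ?Q}"
  proof (rule card_eq_mult_card_fibres[where f = "\<lambda>(a, b). a ^ 2"])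
    show "(\<lambda>(a, b). a ^ 2) ` ?T \<subseteq> {y. y \<in> ?Q \<and> d - y \<in> ?Q}"
      by (auto simp: nonzero_squares_altdef)
    fix y assume "y \<in> {y. y \<in> ?Q \<and> d - y \<in> ?Q}"
    then have y: "y \<in> ?Q" "d - y \<in> ?Q"
      by auto
    have "{p \<in> ?T. (case p of (a, b) \<Rightarrow> a ^ 2) = y} =
        {a. a ^ 2 = y \<and> a \<noteq> 0} \<times> {b. b ^ 2 = d - y \<and> b \<noteq> 0}"
      by (auto simp: algebra_simps)
    then show "card {p \<in> ?T. (case p of (a, b) \<Rightarrow> a ^ 2) = y} = 4"
      using card_square_roots[OF y(1)] card_square_roots[OF y(2)] by (simp add: card_cartesian_product)
  qed auto
  have R: "card ?R = 2 * of_bool (d \<in> ?Q)"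
  proof (cases "d \<in> ?Q")
    case True
    then show ?thesis using card_square_roots[of d] by simp
  next
    case False
    then have "?R = {}"
      using assms by (auto simp: nonzero_squares_altdef)
    with False show ?thesis by simp
  qed
  have "?S = ?T \<union> ({0} \<times> ?R \<union> ?R \<times> {0})"
    by auto
  moreover have "card (?T \<union> ({0} \<times> ?R \<union> ?R \<times> {0})) = card ?T + (card ({0 :: 'a} \<times> ?R) + card (?R \<times> {0 :: 'a}))"
    using assms by (subst card_Un_disjoint; (subst card_Un_disjoint)?) auto
  ultimately have "card ?S = card ?T + 2 * card ?R"
    by (simp add: card_cartesian_product)
  then show ?thesis
    using T R card_sum_two_squares[OF assms] by simp
qed

section \<open>The adjacency matrix over the two-element field\<close>

definition adj :: "'a \<Rightarrow> 'a \<Rightarrow> bit" where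
  "adj x y = of_bool (x - y \<in> nonzero_squares)"

definition adj_op :: "('a \<Rightarrow> bit) \<Rightarrow> 'a \<Rightarrow> bit" where
  "adj_op u x = (\<Sum>y\<in>UNIV. adj x y * u y)"

lemma sum_of_bool_bit: "(\<Sum>x\<in>(UNIV :: 'a set). of_bool (P x)) = (of_nat (card {x. P x}) :: bit)"
  by (simp add: of_bool_def flip: sum.inter_filter)

lemma adj_commute: "adj x y = adj y x"
  using uminus_in_nonzero_squares[of "x - y"] by (simp add: adj_def)

lemma adj_op_add: "adj_op (\<lambda>x. u x + v x) x = adj_op u x + adj_op v x"
  by (simp add: adj_op_def sum.distrib distrib_left)

lemma sum_adj: "(\<Sum>y\<in>UNIV. adj x y) = 0"
proof -
  have "bij_betw (\<lambda>y. x - y) {y. x - y \<in> nonzero_squares} nonzero_squares"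
    by (rule bij_betwI[where g = "\<lambda>y. x - y"]) auto
  then have "card {y. x - y \<in> nonzero_squares} = 2 * (CARD('a) div 4)"
    using card_nonzero_squares bij_betw_same_card by metis
  then show ?thesis
    by (simp add: adj_def sum_of_bool_bit of_nat_bit)
qed

lemma of_nat_card_field: "of_nat (CARD('a)) = (1 :: bit)"
proof -
  have "odd (CARD('a))"
    using card_field by presburger
  then show ?thesis
    by (simp add: of_nat_bit)
qed

lemma adj_op_const: "adj_op (\<lambda>_. c) x = 0"
  by (simp add: adj_op_def sum_adj flip: sum_distrib_right)

lemma sum_adj_op: "(\<Sum>x\<in>UNIV. adj_op u x) = 0"
proof -
  have "(\<Sum>x\<in>UNIV. adj_op u x) = (\<Sum>y\<in>UNIV. (\<Sum>x\<in>UNIV. adj y x) * u y)"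
    unfolding adj_op_def by (subst sum.swap) (simp add: sum_distrib_right adj_commute)
  then show ?thesis
    by (simp add: sum_adj)
qed

text \<open>This is \<open>A\<^sup>2 = A + \<mu> (I + J)\<close> read entry by entry. Off the
  diagonal the left side counts common neighbours modulo 2; on it, the left side is a degree, hence
  even, and the factor of \<open>\<mu>\<close> is \<open>1 + 1 = 0\<close>.\<close>

lemma adj_square:
  "(\<Sum>y\<in>UNIV. adj x y * adj y z) = adj x z + of_nat (CARD('a) div 4) * (1 + of_bool (x = z))"
proof (cases "x = z")
  case True
  \<comment> \<open>The matrix is symmetric with entries 0 and 1, so the products are the entries
    themselves.\<close>
  have "(\<Sum>y\<in>UNIV. adj x y * adj y x) = (\<Sum>y\<in>UNIV. adj x y)"
    by (intro sum.cong refl) (subst adj_commute[of _ x], simp add: adj_def)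
  then show ?thesis
    using True by (simp add: sum_adj) (simp add: adj_def nonzero_squares_def)
next
  case False
  let ?C = "{t. t \<in> nonzero_squares \<and> (x - z) - t \<in> nonzero_squares}"
  have "(\<Sum>y\<in>UNIV. adj x y * adj y z) =
      of_nat (card {y. x - y \<in> nonzero_squares \<and> y - z \<in> nonzero_squares})"
    by (simp add: adj_def sum_of_bool_bit flip: of_bool_conj)
  also have "bij_betw (\<lambda>y. x - y) {y. x - y \<in> nonzero_squares \<and> y - z \<in> nonzero_squares} ?C"
    by (rule bij_betwI[where g = "\<lambda>t. x - t"]) (auto simp: algebra_simps)
  then have "card {y. x - y \<in> nonzero_squares \<and> y - z \<in> nonzero_squares} = card ?C"
    by (rule bij_betw_same_card)
  \<comment> \<open>Adding the adjacency indicator twice changes nothing in characteristic 2, but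
    creates the sum evaluated by \<open>card_common_neighbours\<close>.\<close>
  also have "of_nat (card ?C) = (of_nat (card ?C + of_bool (x - z \<in> nonzero_squares)) + adj x z :: bit)"
    by (simp add: adj_def)
  also have "card ?C + of_bool (x - z \<in> nonzero_squares) = CARD('a) div 4"
    by (rule card_common_neighbours) (use False in simp)
  finally show ?thesis
    using False by simp
qed

lemma adj_op_adj_op:
  "adj_op (adj_op u) x = adj_op u x + of_nat (CARD('a) div 4) * ((\<Sum>y\<in>UNIV. u y) + u x)"
proof -
  have "adj_op (adj_op u) x = (\<Sum>z\<in>UNIV. (\<Sum>y\<in>UNIV. adj x y * adj y z) * u z)"
    unfolding adj_op_def sum_distrib_left sum_distrib_right
    by (subst sum.swap) (simp add: mult.assoc)
  also have "\<dots> = (\<Sum>z\<in>UNIV. adj x z * u z + of_nat (CARD('a) div 4) * (u z + of_bool (x = z) * u z))"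
    unfolding adj_square by (simp add: algebra_simps)
  also have "\<dots> = adj_op u x + of_nat (CARD('a) div 4) * ((\<Sum>y\<in>UNIV. u y) + (\<Sum>z\<in>UNIV. of_bool (x = z) * u z))"
    unfolding adj_op_def by (simp add: sum.distrib flip: sum_distrib_left)
  also have "(\<Sum>z\<in>UNIV. of_bool (x = z) * u z) = u x"
    by (simp add: of_bool_def if_distrib if_distribR cong: if_cong)
  finally show ?thesis .
qed

section \<open>Size of the kernel\<close>

definition adj_kernel :: "('a \<Rightarrow> bit) set" where
  "adj_kernel = {u. \<forall>x. adj_op u x = 0}"

text \<open>In characteristic 2 this is the kernel of \<open>I + A\<close>.\<close>

definition adj_fixed :: "('a \<Rightarrow> bit) set" where
  "adj_fixed = {u. \<forall>x. adj_op u x = u x}"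

lemma adj_kernel_trivial:
  assumes "[CARD('a) = 5] (mod 8)"
  shows "adj_kernel = {\<lambda>_. 0, \<lambda>_. 1}"
proof
  have "odd (CARD('a) div 4)"
    using assms unfolding cong_def by presburger
  then have odd: "of_nat (CARD('a) div 4) = (1 :: bit)"
    by (simp add: of_nat_bit)
  show "adj_kernel \<subseteq> {\<lambda>_. 0, \<lambda>_. 1}"
  proof
    fix u assume "u \<in> adj_kernel"
    then have "adj_op u = (\<lambda>_. 0)"
      by (auto simp: adj_kernel_def)
    moreover obtain c where c: "(\<Sum>y\<in>UNIV. u y) = c"
      by blast
    \<comment> \<open>For odd \<open>\<mu>\<close> the formula for \<open>A\<^sup>2\<close> reduces
      on a kernel vector to \<open>0 = c + u x\<close>, where \<open>c\<close> does not depend on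
      \<open>x\<close>.\<close>
    ultimately have "c = u x" for x
      using adj_op_adj_op[of u x] odd by (simp add: adj_op_const bit_add_eq_0_iff)
    then have "u = (\<lambda>_. c)"
      by auto
    then show "u \<in> {\<lambda>_. 0, \<lambda>_. 1}"
      by (cases c) auto
  qed
qed (auto simp: adj_kernel_def adj_op_const)

lemma card_kernel_times_fixed:
  assumes "[CARD('a) = 1] (mod 8)"
  shows "card adj_kernel * card adj_fixed = 2 ^ CARD('a)"
proof -
  have "even (CARD('a) div 4)"
    using assms unfolding cong_def by presburger
  then have idem: "adj_op (adj_op u) x = adj_op u x" for u x
    by (simp add: adj_op_adj_op of_nat_bit)
  \<comment> \<open>Idempotence splits each \<open>u\<close> uniquely into the kernel vector
    \<open>u + A u\<close> and the fixed vector \<open>A u\<close>.\<close>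
  have "bij_betw (\<lambda>(u, v) x. u x + v x) (adj_kernel \<times> adj_fixed) UNIV"
    by (rule bij_betwI[where g = "\<lambda>u. (\<lambda>x. u x + adj_op u x, adj_op u)"])
      (auto simp: adj_kernel_def adj_fixed_def adj_op_add idem fun_eq_iff add.assoc)
  then have "card (adj_kernel \<times> adj_fixed) = CARD('a \<Rightarrow> bit)"
    by (rule bij_betw_same_card)
  also have "\<dots> = 2 ^ CARD('a)"
    by (simp add: card_fun card_bit)
  finally show ?thesis
    by (simp add: card_cartesian_product)
qed

text \<open>The kernel of the adjacency matrix \<open>I + J + A\<close> of the complement graph.\<close>

definition coadj_kernel :: "('a \<Rightarrow> bit) set" where
  "coadj_kernel = {u. \<forall>x. adj_op u x + u x = (\<Sum>y\<in>UNIV. u y)}"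

text \<open>Scaling by a nonsquare \<open>g\<close> is an isomorphism between the graph and its
  complement, so the substitution \<open>u (g * y)\<close> carries one kernel onto the
  other.\<close>

lemma card_coadj_kernel: "card coadj_kernel = card adj_kernel"
proof -
  obtain g :: 'a where g: "g \<noteq> 0" "\<And>x. g * x \<in> nonzero_squares \<longleftrightarrow> x \<noteq> 0 \<and> x \<notin> nonzero_squares"
    by (rule obtain_nonsquare) blast
  have adj_g: "adj (g * x) (g * y) = 1 + of_bool (x = y) + adj x y" for x y
    using g(2)[of "x - y"] by (auto simp: adj_def algebra_simps nonzero_squares_def)
  have bij_g: "bij_betw ((*) g) UNIV UNIV"
    by (rule bij_betwI[where g = "\<lambda>x. x / g"]) (use g in auto)
  have op_g: "adj_op u (g * x) = (\<Sum>y\<in>UNIV. u (g * y)) + u (g * x) + adj_op (\<lambda>y. u (g * y)) x" for u x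
  proof -
    have "adj_op u (g * x) = (\<Sum>y\<in>UNIV. adj (g * x) (g * y) * u (g * y))"
      unfolding adj_op_def using sum.reindex_bij_betw[OF bij_g, of "\<lambda>y. adj (g * x) y * u y"] by simp
    also have "\<dots> = (\<Sum>y\<in>UNIV. u (g * y)) + (\<Sum>y\<in>UNIV. of_bool (x = y) * u (g * y)) + adj_op (\<lambda>y. u (g * y)) x"
      unfolding adj_g adj_op_def by (simp add: distrib_right sum.distrib)
    also have "(\<Sum>y\<in>UNIV. of_bool (x = y) * u (g * y)) = u (g * x)"
      by (simp add: of_bool_def if_distrib if_distribR cong: if_cong)
    finally show ?thesis .
  qed
  have surj: "(\<forall>x. P (g * x)) \<longleftrightarrow> (\<forall>x. P x)" for P
    using g by (metis nonzero_mult_div_cancel_left times_divide_eq_right)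
  have iff: "(\<lambda>y. u (g * y)) \<in> coadj_kernel \<longleftrightarrow> u \<in> adj_kernel" for u
  proof -
    have *: "c + b + a = 0 \<longleftrightarrow> a + b = c" for a b c :: bit
      by (cases a; cases b; cases c) auto
    have "(\<lambda>y. u (g * y)) \<in> coadj_kernel \<longleftrightarrow> (\<forall>x. adj_op u (g * x) = 0)"
      unfolding coadj_kernel_def op_g by (simp add: *)
    then show ?thesis
      using surj[of "\<lambda>x. adj_op u x = 0"] by (simp add: adj_kernel_def)
  qed
  have "bij_betw (\<lambda>u y. u (g * y)) adj_kernel coadj_kernel"
  proof (rule bij_betwI[where g = "\<lambda>u y. u (y / g)"])
    show "(\<lambda>u y. u (y / g)) \<in> coadj_kernel \<rightarrow> adj_kernel"
      using g by (auto simp flip: iff)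
  qed (use g iff in auto)
  then show ?thesis
    by (metis bij_betw_same_card)
qed

text \<open>Fixed vectors have even weight because the column sums of \<open>A\<close> vanish, so
  they are the even-weight half of \<open>coadj_kernel\<close>. As the order of the field is odd,
  adding the all-ones vector exchanges this half with the odd-weight one.\<close>

lemma card_coadj_kernel_fixed: "card coadj_kernel = 2 * card adj_fixed"
proof -
  have fixed: "adj_fixed = {u \<in> coadj_kernel. (\<Sum>y\<in>UNIV. u y) = 0}"
  proof (intro equalityI subsetI)
    fix u assume "u \<in> adj_fixed"
    then have u: "adj_op u = u"
      by (auto simp: adj_fixed_def)
    then have "(\<Sum>y\<in>UNIV. u y) = 0"
      using sum_adj_op[of u] by simp
    with u show "u \<in> {u \<in> coadj_kernel. (\<Sum>y\<in>UNIV. u y) = 0}"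
      by (simp add: coadj_kernel_def)
  next
    fix u assume "u \<in> {u \<in> coadj_kernel. (\<Sum>y\<in>UNIV. u y) = 0}"
    then have "adj_op u x + u x = 0" for x
      by (simp add: coadj_kernel_def)
    then show "u \<in> adj_fixed"
      by (auto simp: adj_fixed_def bit_add_eq_0_iff)
  qed
  have shift: "(\<lambda>x. u x + 1) \<in> coadj_kernel \<longleftrightarrow> u \<in> coadj_kernel" for u
    by (simp add: coadj_kernel_def adj_op_add adj_op_const sum.distrib of_nat_card_field flip: add.assoc)
  let ?Z = "\<lambda>c. {u \<in> coadj_kernel. (\<Sum>y\<in>UNIV. u y) = c}"
  have "bij_betw (\<lambda>u x. u x + 1) (?Z 0) (?Z 1)"
    by (rule bij_betwI[where g = "\<lambda>u x. u x + 1"])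
      (auto simp: shift sum.distrib of_nat_card_field add.assoc)
  then have "card (?Z 0) = card (?Z 1)"
    by (rule bij_betw_same_card)
  moreover have "coadj_kernel = ?Z 0 \<union> ?Z 1" "?Z 0 \<inter> ?Z 1 = {}"
    by auto
  then have "card coadj_kernel = card (?Z 0) + card (?Z 1)"
    using card_Un_disjoint[of "?Z 0" "?Z 1"] by simp
  ultimately show ?thesis
    unfolding fixed by simp
qed

lemma card_adj_kernel:
  assumes "[CARD('a) = 1] (mod 8)"
  shows "card adj_kernel = 2 ^ ((CARD('a) + 1) div 2)"
proof -
  have "card adj_kernel ^ 2 = 2 * (card adj_kernel * card adj_fixed)"
    using card_coadj_kernel card_coadj_kernel_fixed by (simp add: power2_eq_square)
  also have "\<dots> = 2 ^ (CARD('a) + 1)"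
    using card_kernel_times_fixed[OF assms] by simp
  \<comment> \<open>The order is odd, so the halving is exact and the power is a perfect
    square.\<close>
  also have "CARD('a) + 1 = (CARD('a) + 1) div 2 * 2"
    using card_field by presburger
  finally have "card adj_kernel ^ 2 = (2 ^ ((CARD('a) + 1) div 2)) ^ 2"
    by (simp only: power_mult)
  then show ?thesis
    by simp
qed

section \<open>From kernel vectors to even-even partitions\<close>

lemma even_graph_paley_induced:
  "even_graph (with_proj (paley_graph :: 'a pair_pre_digraph) \<restriction> S) \<longleftrightarrow>
    (\<forall>v\<in>S. adj_op (\<lambda>y. of_bool (y \<in> S)) v = 0)"
proof -
  let ?P = "with_proj (paley_graph :: 'a pair_pre_digraph)"
  have "even (out_degree (?P \<restriction> S) v) \<longleftrightarrow> adj_op (\<lambda>y. of_bool (y \<in> S)) v = 0" if "v \<in> S" for v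
  proof -
    have "out_arcs (?P \<restriction> S) v = Pair v ` {y. v - y \<in> nonzero_squares \<and> y \<in> S}"
      using that by (auto simp: out_arcs_def paley_graph_def nonzero_squares_def)
    then have "out_degree (?P \<restriction> S) v = card {y. v - y \<in> nonzero_squares \<and> y \<in> S}"
      by (simp add: out_degree_def card_image inj_on_def)
    moreover have "adj_op (\<lambda>y. of_bool (y \<in> S)) v = of_nat (card {y. v - y \<in> nonzero_squares \<and> y \<in> S})"
      by (simp add: adj_op_def adj_def sum_of_bool_bit flip: of_bool_conj)
    ultimately show ?thesis
      by (simp add: of_nat_bit)
  qed
  then show ?thesis
    by (simp add: even_graph_def)
qed

text \<open>Since all degrees are even, a vertex has as many neighbours in \<open>S\<close> as in
  \<open>- S\<close> modulo 2. Evenness on \<open>- S\<close> therefore supplies the kernel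
  equations at the vertices outside \<open>S\<close>.\<close>

lemma even_even_partition_paley_iff:
  "even_even_partition (with_proj (paley_graph :: 'a pair_pre_digraph)) S T \<longleftrightarrow>
    T = - S \<and> (\<lambda>y. of_bool (y \<in> S)) \<in> adj_kernel"
proof -
  have "adj_op (\<lambda>y. of_bool (y \<in> - S)) v = adj_op (\<lambda>y. of_bool (y \<in> S) + 1) v" for v
    by (rule arg_cong[where f = "\<lambda>u. adj_op u v"]) auto
  then have "adj_op (\<lambda>y. of_bool (y \<in> - S)) v = adj_op (\<lambda>y. of_bool (y \<in> S)) v" for v
    by (simp add: adj_op_add adj_op_const)
  then have "even_graph (with_proj (paley_graph :: 'a pair_pre_digraph) \<restriction> S) \<and>
      even_graph (with_proj (paley_graph :: 'a pair_pre_digraph) \<restriction> (- S)) \<longleftrightarrow>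
      (\<lambda>y. of_bool (y \<in> S)) \<in> adj_kernel"
    unfolding even_graph_paley_induced adj_kernel_def by auto
  moreover have "S \<union> T = UNIV \<and> S \<inter> T = {} \<longleftrightarrow> T = - S"
    by auto
  ultimately show ?thesis
    unfolding even_even_partition_def by (auto simp: paley_graph_def)
qed

lemma coeven_paley_eq_image:
  "coeven_induced_subgraphs (with_proj (paley_graph :: 'a pair_pre_digraph)) =
    (\<lambda>u. with_proj paley_graph \<restriction> {x. u x = 1}) ` adj_kernel"
proof (intro equalityI subsetI)
  fix H :: "('a, 'a \<times> 'a) pre_digraph"
  assume "H \<in> coeven_induced_subgraphs (with_proj paley_graph)"
  then obtain S where S: "H = with_proj paley_graph \<restriction> S" "(\<lambda>y. of_bool (y \<in> S)) \<in> adj_kernel"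
    unfolding coeven_induced_subgraphs_def even_even_partition_paley_iff by blast
  then show "H \<in> (\<lambda>u. with_proj paley_graph \<restriction> {x. u x = 1}) ` adj_kernel"
    by (intro image_eqI[OF _ S(2)]) simp
next
  fix H :: "('a, 'a \<times> 'a) pre_digraph"
  assume "H \<in> (\<lambda>u. with_proj paley_graph \<restriction> {x. u x = 1}) ` adj_kernel"
  then obtain u where u: "u \<in> adj_kernel" "H = with_proj paley_graph \<restriction> {x. u x = 1}"
    by blast
  moreover have "(\<lambda>y. of_bool (y \<in> {x. u x = 1})) = u"
    by (auto simp: fun_eq_iff)
  ultimately show "H \<in> coeven_induced_subgraphs (with_proj paley_graph)"
    unfolding coeven_induced_subgraphs_def even_even_partition_paley_iff by auto
qed

lemma card_coeven_paley:
  "card (coeven_induced_subgraphs (with_proj (paley_graph :: 'a pair_pre_digraph))) = card adj_kernel"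
proof -
  have "u = v" if "with_proj (paley_graph :: 'a pair_pre_digraph) \<restriction> {x. u x = 1} =
      with_proj paley_graph \<restriction> {x. v x = 1}" for u v :: "'a \<Rightarrow> bit"
  proof -
    have "{x. u x = 1} = {x. v x = 1}"
      using arg_cong[OF that, of verts] by simp
    then have "u x = 1 \<longleftrightarrow> v x = 1" for x
      by blast
    then show ?thesis
      by (metis bit_not_one_iff ext)
  qed
  then show ?thesis
    unfolding coeven_paley_eq_image by (intro card_image inj_onI) blast
qed

end

theorem theorem1p3:
  fixes q N :: nat
    and P :: "'a :: {field, finite} pair_pre_digraph"
  assumes "primepow q"
    and "[q = 1] (mod 4)"
    and "CARD('a) = q"
  defines "P \<equiv> paley_graph"
    and "N \<equiv> card (coeven_induced_subgraphs (with_proj P))"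
  shows "([q = 1] (mod 8) \<longrightarrow> N = 2 ^ ((q + 1) div 2)) \<and>
         ([q = 5] (mod 8) \<longrightarrow> N = 2) \<and>
         ([q = 5] (mod 8) \<longrightarrow>
            coeven_induced_subgraphs (with_proj P) =
              {with_proj \<lparr>pverts = {}, parcs = {}\<rparr>, with_proj P})"
proof -
  interpret field_card_1_mod_4 "TYPE('a)"
    by standard (use assms(2,3) in simp)
  have N: "N = card (adj_kernel :: ('a \<Rightarrow> bit) set)"
    unfolding N_def P_def by (rule card_coeven_paley)
  have empty: "with_proj P \<restriction> {} = with_proj \<lparr>pverts = {}, parcs = {}\<rparr>"
    by (simp add: induce_subgraph_def with_proj_def)
  have full: "with_proj P \<restriction> UNIV = with_proj P"
    by (simp add: induce_subgraph_def with_proj_def P_def paley_graph_def)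
  \<comment> \<open>The zero vector selects the empty vertex set and the all-ones vector selects
    every vertex.\<close>
  have "coeven_induced_subgraphs (with_proj P) =
      {with_proj \<lparr>pverts = {}, parcs = {}\<rparr>, with_proj P}" if "[q = 5] (mod 8)"
    unfolding P_def coeven_paley_eq_image adj_kernel_trivial[OF that[folded assms(3)]]
    by (simp add: empty[unfolded P_def] full[unfolded P_def])
  moreover have "N = 2" if "[q = 5] (mod 8)"
    unfolding N adj_kernel_trivial[OF that[folded assms(3)]] by (simp add: fun_eq_iff)
  moreover have "N = 2 ^ ((q + 1) div 2)" if "[q = 1] (mod 8)"
    using that card_adj_kernel assms(3) N by simp
  ultimately show ?thesis
    by blast
qed

end
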